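(* Let $G$ be a finite abelian group. Let $S$ be a nonempty inverse-closed proper subset of $G\setminus\{0\}$ with $\langle S\rangle=G$, let $S_0=S\cup\{0\}$, and let $H=G_{S_0}=\{g\in G: S_0+g=S_0\}$. Then $\mathrm{Cay}(G,S)$ admits a perfect code if and only if $\mathrm{Cay}(G/H,(S/H)\setminus\{H\})$ admits a perfect code. Moreover, for any perfect code $X$ in $\mathrm{Cay}(G,S)$, $X/H$ is a perfect code in $\mathrm{Cay}(G/H,(S/H)\setminus\{H\})$; conversely, any perfect code $X/H$ in $\mathrm{Cay}(G/H,(S/H)\setminus\{H\})$ gives rise to $|H|^k$ perfect codes in $\mathrm{Cay}(G,S)$, where $k=|X/H|$, each of which is formed by taking exactly one element from each coset of $H$ belonging to $X/H$.
   Context: Abelian groups are written additively with identity $0$. Inverse-closed means $-S=S$. For an inverse-closed subset $S\subseteq G\setminus\{0\}$, the Cayley graph $\mathrm{Cay}(G,S)$ has vertex set $G$, with $x,y$ adjacent iff $y-x\in S$. A perfect code in a graph is a set $C$ of vertices such that no two vertices in $C$ are adjacent and every vertex outside $C$ is adjacent to exactly one vertex of $C$. For a subset $X\subseteq G$ and a subgroup $H\le G$, $X/H=\{H+x: x\in X\}\subseteq G/H$. *)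

theory Defs
  imports "HOL-Algebra.Coset" "HOL-Algebra.Generated_Groups" "Graph_Theory.Pair_Digraph"
begin

text \<open>
  Groups are HOL-Algebra structures and therefore written multiplicatively:
  addition, the identity and the negative of x are \<open>\<otimes>\<close>, \<open>\<one>\<close> and \<open>inv x\<close>.
  The identity element of the quotient group \<open>G Mod H\<close> is the coset \<open>H\<close> itself.
\<close>

definition cayley_graph :: "('a, 'm) monoid_scheme \<Rightarrow> 'a set \<Rightarrow> 'a pair_pre_digraph" where
  "cayley_graph G S =
    \<lparr> pverts = carrier G,
      parcs = {(x, y). x \<in> carrier G \<and> y \<in> carrier G \<and> y \<otimes>\<^bsub>G\<^esub> inv\<^bsub>G\<^esub> x \<in> S} \<rparr>"

text \<open>
  Undirected simple graphs are symmetric, loop-free digraphs (\<open>pair_graph\<close>), so the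
  orientation of the arcs below is immaterial.
\<close>

definition perfect_code :: "'v pair_pre_digraph \<Rightarrow> 'v set \<Rightarrow> bool" where
  "perfect_code \<Gamma> C \<longleftrightarrow>
    C \<subseteq> pverts \<Gamma> \<and>
    (\<forall>x\<in>C. \<forall>y\<in>C. (x, y) \<notin> parcs \<Gamma>) \<and>
    (\<forall>v\<in>pverts \<Gamma> - C. \<exists>!c. c \<in> C \<and> (v, c) \<in> parcs \<Gamma>)"

text \<open>\<open>G\<^sub>A = {g \<in> G. A + g = A}\<close>\<close>

definition translation_stabilizer :: "('a, 'm) monoid_scheme \<Rightarrow> 'a set \<Rightarrow> 'a set" where
  "translation_stabilizer G A = {g \<in> carrier G. A #>\<^bsub>G\<^esub> g = A}"

text \<open>\<open>A/H = {H + x | x \<in> A}\<close>\<close>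

definition coset_image :: "('a, 'm) monoid_scheme \<Rightarrow> 'a set \<Rightarrow> 'a set \<Rightarrow> 'a set set" where
  "coset_image G H A = (\<lambda>x. H #>\<^bsub>G\<^esub> x) ` A"

text \<open>The sets formed by taking exactly one element from each member of \<open>\<C>\<close>, for a
  family \<open>\<C>\<close> of pairwise disjoint sets (here: cosets).\<close>

definition transversals :: "'a set set \<Rightarrow> 'a set set" where
  "transversals \<C> = {Y. Y \<subseteq> \<Union>\<C> \<and> (\<forall>K\<in>\<C>. \<exists>!y. y \<in> Y \<inter> K)}"

lemma pair_graph_cayley_graph:
  fixes G :: "('a, 'm) monoid_scheme"
  assumes "group G" and "finite (carrier G)"
    and S: "S \<subseteq> carrier G - {\<one>\<^bsub>G\<^esub>}" and inv: "(\<lambda>s. inv\<^bsub>G\<^esub> s) ` S = S"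
  shows "pair_graph (cayley_graph G S)"
proof -
  interpret group G by fact
  have "finite (carrier G \<times> carrier G)"
    using assms(2) by simp
  then have fin: "finite (parcs (cayley_graph G S))"
    by (rule rev_finite_subset) (auto simp: cayley_graph_def)
  have sym: "(y, x) \<in> parcs (cayley_graph G S)" if "(x, y) \<in> parcs (cayley_graph G S)" for x y
  proof -
    from that have xy: "x \<in> carrier G" "y \<in> carrier G" and m: "y \<otimes>\<^bsub>G\<^esub> inv\<^bsub>G\<^esub> x \<in> S"
      by (auto simp: cayley_graph_def)
    have "inv\<^bsub>G\<^esub> (y \<otimes>\<^bsub>G\<^esub> inv\<^bsub>G\<^esub> x) \<in> S"
      using m inv by blast
    moreover have "inv\<^bsub>G\<^esub> (y \<otimes>\<^bsub>G\<^esub> inv\<^bsub>G\<^esub> x) = x \<otimes>\<^bsub>G\<^esub> inv\<^bsub>G\<^esub> y"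
      using xy by (simp add: inv_mult_group)
    ultimately show ?thesis
      using xy by (simp add: cayley_graph_def)
  qed
  show ?thesis
  proof
    show "symmetric (with_proj (cayley_graph G S))"
      unfolding symmetric_def using sym by (auto intro: symI)
  qed (use assms(2) S fin in \<open>auto simp: cayley_graph_def\<close>)
qed

lemma subgroup_translation_stabilizer:
  fixes G :: "('a, 'm) monoid_scheme"
  assumes "group G" and A: "A \<subseteq> carrier G"
  shows "subgroup (translation_stabilizer G A) G"
proof -
  interpret group G by fact
  show ?thesis
  proof (rule subgroupI)
    show "translation_stabilizer G A \<subseteq> carrier G"
      by (auto simp: translation_stabilizer_def)
    have "\<one>\<^bsub>G\<^esub> \<in> translation_stabilizer G A"
      using A by (simp add: translation_stabilizer_def)
    then show "translation_stabilizer G A \<noteq> {}"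
      by blast
  next
    fix a assume "a \<in> translation_stabilizer G A"
    then have a: "a \<in> carrier G" "A #>\<^bsub>G\<^esub> a = A"
      by (auto simp: translation_stabilizer_def)
    have "(A #>\<^bsub>G\<^esub> a) #>\<^bsub>G\<^esub> inv\<^bsub>G\<^esub> a = A"
      using a(1) A by (simp add: coset_mult_assoc)
    then show "inv\<^bsub>G\<^esub> a \<in> translation_stabilizer G A"
      using a by (simp add: translation_stabilizer_def)
  next
    fix a b assume "a \<in> translation_stabilizer G A" "b \<in> translation_stabilizer G A"
    then show "a \<otimes>\<^bsub>G\<^esub> b \<in> translation_stabilizer G A"
      using A by (simp add: translation_stabilizer_def flip: coset_mult_assoc)
  qed
qed

end

theory Submission
  imports Defs
begin

text \<open>
  In a Cayley graph the closed neighbourhood of \<open>v\<close> is the translate \<open>S\<^sub>0 v\<close>, so \<open>C\<close> is a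
  perfect code iff every \<open>v\<close> has exactly one \<open>c \<in> C\<close> with \<open>c v\<^sup>-\<^sup>1 \<in> S\<^sub>0\<close>
  (\<open>perfect_code_cayley_iff\<close>); adjacency and membership in \<open>C\<close> need no separate treatment.

  Since \<open>H\<close> stabilizes \<open>S\<^sub>0\<close>, the set \<open>S\<^sub>0\<close> is a union of \<open>H\<close>-cosets.  Whether
  \<open>c v\<^sup>-\<^sup>1\<close> lies in \<open>S\<^sub>0\<close> is therefore decided by the cosets of \<open>c\<close> and \<open>v\<close>, and the covering
  condition for \<open>C\<close> in \<open>G\<close> is the one for its image in \<open>G/H\<close>, up to counting several elements of
  \<open>C\<close> in one coset separately.  Hence \<open>C\<close> is a perfect code iff it meets each coset at most once and
  its image is a perfect code (\<open>perfect_code_cayley_quotient_iff\<close>).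

  Read from left to right this is the projection of perfect codes to the quotient.  Read from right
  to left it says that the perfect codes above a given quotient code \<open>\<C>\<close> are its transversals.
  A transversal is a choice of one element from each of \<open>card \<C>\<close> disjoint sets of size \<open>card H\<close>,
  whence the count, which is positive and so also shows that a code of the quotient lifts.
\<close>

section \<open>Perfect codes as unique coverings\<close>

text \<open>Putting \<open>\<one>\<close> into the connection set merges the two clauses of the definition: an element
  of \<open>C\<close> is covered by itself, and independence says that nothing else covers it.\<close>

lemma perfect_code_cayley_iff:
  fixes G (structure)
  assumes "group G" and "\<one> \<in> T"
  shows "perfect_code (cayley_graph G (T - {\<one>})) C \<longleftrightarrow>
    C \<subseteq> carrier G \<and> (\<forall>v\<in>carrier G. \<exists>!c. c \<in> C \<and> c \<otimes> inv v \<in> T)"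
proof (cases "C \<subseteq> carrier G")
  case False
  then show ?thesis by (simp add: perfect_code_def cayley_graph_def)
next
  case C: True
  interpret group G by fact
  have arc: "(v, c) \<in> parcs (cayley_graph G (T - {\<one>})) \<longleftrightarrow> c \<otimes> inv v \<in> T \<and> c \<noteq> v"
    if "v \<in> carrier G" "c \<in> C" for v c
  proof -
    have "c \<otimes> inv v = \<one> \<longleftrightarrow> c = v"
      using that C by (metis inv_solve_right l_one one_closed subsetD)
    then show ?thesis
      using that C by (auto simp: cayley_graph_def)
  qed
  have self: "c \<otimes> inv c \<in> T" if "c \<in> C" for c
    using that C \<open>\<one> \<in> T\<close> by (simp add: subset_iff)
  have inside: "(\<forall>x\<in>C. \<forall>y\<in>C. (x, y) \<notin> parcs (cayley_graph G (T - {\<one>}))) \<longleftrightarrow>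
      (\<forall>v\<in>C. \<exists>!c. c \<in> C \<and> c \<otimes> inv v \<in> T)"
    using C arc self by (smt (verit, ccfv_threshold) subsetD)
  have outside: "(\<exists>!c. c \<in> C \<and> (v, c) \<in> parcs (cayley_graph G (T - {\<one>}))) \<longleftrightarrow>
      (\<exists>!c. c \<in> C \<and> c \<otimes> inv v \<in> T)" if "v \<in> carrier G - C" for v
  proof -
    have "(\<lambda>c. c \<in> C \<and> (v, c) \<in> parcs (cayley_graph G (T - {\<one>}))) =
        (\<lambda>c. c \<in> C \<and> c \<otimes> inv v \<in> T)"
      using that arc by (intro ext) blast
    then show ?thesis by simp
  qed
  define covered where "covered v \<longleftrightarrow> (\<exists>!c. c \<in> C \<and> c \<otimes> inv v \<in> T)" for v
  have vertices: "pverts (cayley_graph G (T - {\<one>})) = carrier G"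
    by (simp add: cayley_graph_def)
  have "(\<forall>v\<in>carrier G - C. \<exists>!c. c \<in> C \<and> (v, c) \<in> parcs (cayley_graph G (T - {\<one>}))) \<longleftrightarrow>
      (\<forall>v\<in>carrier G - C. covered v)"
    unfolding covered_def by (rule ball_cong[OF refl outside])
  then have "perfect_code (cayley_graph G (T - {\<one>})) C \<longleftrightarrow>
      (\<forall>v\<in>C. covered v) \<and> (\<forall>v\<in>carrier G - C. covered v)"
    using C by (simp only: perfect_code_def inside vertices covered_def simp_thms)
  moreover have "C \<union> (carrier G - C) = carrier G"
    using C by (simp add: Un_absorb1)
  then have "(\<forall>v\<in>carrier G. covered v) \<longleftrightarrow>
      (\<forall>v\<in>C. covered v) \<and> (\<forall>v\<in>carrier G - C. covered v)"
    using ball_Un[of C "carrier G - C" covered] by (simp only:)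
  ultimately show ?thesis
    using C by (simp only: covered_def simp_thms)
qed

section \<open>Passing to a quotient\<close>

text \<open>If \<open>x y\<^sup>-\<^sup>1\<close> shares its coset with some \<open>t \<in> T\<close>, saturation of \<open>T\<close> puts that whole coset, and
  so \<open>x y\<^sup>-\<^sup>1\<close> itself, into \<open>T\<close>.\<close>

lemma quotient_difference_mem_iff:
  fixes G (structure)
  assumes "H \<lhd> G" and T: "T \<subseteq> carrier G" and sat: "\<And>t. t \<in> T \<Longrightarrow> H #> t \<subseteq> T"
    and x: "x \<in> carrier G" and y: "y \<in> carrier G"
  shows "(H #> x) \<otimes>\<^bsub>G Mod H\<^esub> inv\<^bsub>G Mod H\<^esub> (H #> y) \<in> coset_image G H T \<longleftrightarrow> x \<otimes> inv y \<in> T"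
proof -
  interpret normal H G by fact
  interpret Q: group "G Mod H" by (rule factorgroup_is_group)
  interpret P: group_hom G "G Mod H" "\<lambda>a. H #> a"
    by unfold_locales (rule r_coset_hom_Mod)
  have eq: "(H #> x) \<otimes>\<^bsub>G Mod H\<^esub> inv\<^bsub>G Mod H\<^esub> (H #> y) = H #> (x \<otimes> inv y)"
    using x y by (simp only: P.hom_mult P.hom_inv inv_closed)
  have "x \<otimes> inv y \<in> T" if "t \<in> T" "H #> (x \<otimes> inv y) = H #> t" for t
  proof -
    have "x \<otimes> inv y \<in> H #> (x \<otimes> inv y)"
      using x y subgroup_axioms by (intro rcos_self) auto
    then show ?thesis
      using that sat by blast
  qed
  then show ?thesis
    unfolding eq coset_image_def by blast
qed

lemma ex1_image_iff:
  assumes "inj_on f A"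
  shows "(\<exists>!y. y \<in> f ` A \<and> P y) \<longleftrightarrow> (\<exists>!x. x \<in> A \<and> P (f x))"
proof
  assume "\<exists>!y. y \<in> f ` A \<and> P y"
  then obtain y where y: "y \<in> f ` A" "P y" and uniq: "\<And>z. z \<in> f ` A \<Longrightarrow> P z \<Longrightarrow> z = y"
    by blast
  then obtain x where x: "x \<in> A" "y = f x"
    by blast
  show "\<exists>!x. x \<in> A \<and> P (f x)"
  proof (rule ex1I[of _ x])
    show "x \<in> A \<and> P (f x)"
      using x y by simp
  next
    fix x' assume "x' \<in> A \<and> P (f x')"
    then have "f x' = f x"
      using uniq x by blast
    then show "x' = x"
      using assms x \<open>x' \<in> A \<and> P (f x')\<close> by (simp add: inj_on_eq_iff)
  qed
next
  assume "\<exists>!x. x \<in> A \<and> P (f x)"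
  then obtain x where x: "x \<in> A" "P (f x)"
    and uniq: "\<And>z. z \<in> A \<Longrightarrow> P (f z) \<Longrightarrow> z = x"
    by blast
  show "\<exists>!y. y \<in> f ` A \<and> P y"
  proof (rule ex1I[of _ "f x"])
    show "f x \<in> f ` A \<and> P (f x)"
      using x by simp
  next
    fix y assume "y \<in> f ` A \<and> P y"
    then obtain z where z: "z \<in> A" "P (f z)" and y: "y = f z"
      by blast
    show "y = f x"
      unfolding y uniq[OF z] by (rule refl)
  qed
qed

text \<open>Whether \<open>c\<close> covers \<open>v\<close> depends only on their cosets, so both sides count coverings of the same
  cosets.  Injectivity enters because two elements of \<open>C\<close> in one coset cover the same vertices:
  in \<open>G\<close> this violates uniqueness, while the image of \<open>C\<close> does not see it.\<close>

lemma perfect_code_cayley_quotient_iff: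
  fixes G (structure)
  assumes "H \<lhd> G" and T: "T \<subseteq> carrier G" and sat: "\<And>t. t \<in> T \<Longrightarrow> H #> t \<subseteq> T"
    and one: "\<one> \<in> T" and C: "C \<subseteq> carrier G"
  shows "perfect_code (cayley_graph G (T - {\<one>})) C \<longleftrightarrow>
    inj_on (\<lambda>x. H #> x) C \<and>
    perfect_code (cayley_graph (G Mod H) (coset_image G H T - {H})) (coset_image G H C)"
proof -
  interpret normal H G by fact
  let ?\<pi> = "\<lambda>x. H #> x"
  let ?R = "\<lambda>V K. K \<otimes>\<^bsub>G Mod H\<^esub> inv\<^bsub>G Mod H\<^esub> V \<in> coset_image G H T"
  have R: "?R (?\<pi> v) (?\<pi> c) \<longleftrightarrow> c \<otimes> inv v \<in> T" if "v \<in> carrier G" "c \<in> C" for v c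
    using that C quotient_difference_mem_iff[OF \<open>H \<lhd> G\<close> T sat, of c v] by blast
  have carrier: "carrier (G Mod H) = ?\<pi> ` carrier G"
    by (auto simp: FactGroup_def RCOSETS_def)
  have image: "coset_image G H C = ?\<pi> ` C"
    by (simp add: coset_image_def)
  have one_quotient: "\<one>\<^bsub>G Mod H\<^esub> = H"
    by (simp add: FactGroup_def)
  have "\<one>\<^bsub>G Mod H\<^esub> \<in> coset_image G H T"
    using one coset_mult_one[OF subset] one_quotient
    by (auto simp: coset_image_def intro!: image_eqI[of _ _ \<one>])
  note quot_iff = perfect_code_cayley_iff[OF factorgroup_is_group this, of "?\<pi> ` C"]
  have sub: "?\<pi> ` C \<subseteq> ?\<pi> ` carrier G"
    using C by blast
  have quot: "perfect_code (cayley_graph (G Mod H) (coset_image G H T - {H})) (coset_image G H C)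
      \<longleftrightarrow> (\<forall>v\<in>carrier G. \<exists>!K. K \<in> ?\<pi> ` C \<and> ?R (?\<pi> v) K)"
    using quot_iff sub unfolding image carrier one_quotient by (simp only: ball_simps simp_thms)
  have "(\<lambda>c. c \<in> C \<and> ?R (?\<pi> v) (?\<pi> c)) = (\<lambda>c. c \<in> C \<and> c \<otimes> inv v \<in> T)"
    if "v \<in> carrier G" for v
    using that R by (intro ext) blast
  then have base: "perfect_code (cayley_graph G (T - {\<one>})) C \<longleftrightarrow>
      (\<forall>v\<in>carrier G. \<exists>!c. c \<in> C \<and> ?R (?\<pi> v) (?\<pi> c))"
    unfolding perfect_code_cayley_iff[OF is_group one] using C by (simp only: simp_thms cong: ball_cong)
  have inj: "inj_on ?\<pi> C" if code: "\<forall>v\<in>carrier G. \<exists>!c. c \<in> C \<and> ?R (?\<pi> v) (?\<pi> c)"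
  proof (rule inj_onI)
    fix c d assume cd: "c \<in> C" "d \<in> C" and eq: "?\<pi> c = ?\<pi> d"
    have c: "c \<in> carrier G"
      using cd C by blast
    then have "?R (?\<pi> c) (?\<pi> c)"
      using R[of c c] cd one by simp
    with eq have "?R (?\<pi> c) (?\<pi> d)"
      by (simp only:)
    then show "c = d"
      using \<open>?R (?\<pi> c) (?\<pi> c)\<close> cd code[rule_format, OF c] by (elim ex1E) metis
  qed
  show ?thesis
  proof (cases "inj_on ?\<pi> C")
    case True
    have "perfect_code (cayley_graph G (T - {\<one>})) C \<longleftrightarrow>
        perfect_code (cayley_graph (G Mod H) (coset_image G H T - {H})) (coset_image G H C)"
      unfolding base quot by (intro ball_cong refl ex1_image_iff[OF True, symmetric])
    with True show ?thesis
      by (simp only: simp_thms)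
  next
    case False
    then have "\<not> perfect_code (cayley_graph G (T - {\<one>})) C"
      unfolding base using inj by (rule contrapos_nn)
    with False show ?thesis
      by (simp only: simp_thms)
  qed
qed

section \<open>Transversals\<close>

text \<open>Taking images turns choice functions into transversals.  Because the members are disjoint,
  the function can be read off from its image, so choice functions and transversals correspond.\<close>

lemma card_transversals:
  assumes "finite \<C>" and disj: "pairwise disjnt \<C>"
  shows "card (transversals \<C>) = (\<Prod>K\<in>\<C>. card K)"
proof -
  have unique: "K = L" if "K \<in> \<C>" "L \<in> \<C>" "x \<in> K" "x \<in> L" for K L x
    using pairwiseD[OF disj that(1,2)] that(3,4) by (auto simp: disjnt_iff)
  have "bij_betw (\<lambda>f. f ` \<C>) (\<Pi>\<^sub>E K\<in>\<C>. K) (transversals \<C>)"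
  proof (rule bij_betw_imageI)
    show "inj_on (\<lambda>f. f ` \<C>) (\<Pi>\<^sub>E K\<in>\<C>. K)"
    proof (rule inj_onI)
      fix f g assume f: "f \<in> (\<Pi>\<^sub>E K\<in>\<C>. K)" and g: "g \<in> (\<Pi>\<^sub>E K\<in>\<C>. K)" and eq: "f ` \<C> = g ` \<C>"
      show "f = g"
      proof (rule PiE_ext[OF f g])
        fix K assume K: "K \<in> \<C>"
        then obtain L where L: "L \<in> \<C>" "f K = g L"
          using eq by (metis imageE imageI)
        then have "K = L"
          using unique K PiE_mem[OF f K] PiE_mem[OF g L(1)] by metis
        then show "f K = g K"
          using L by simp
      qed
    qed
    show "(\<lambda>f. f ` \<C>) ` (\<Pi>\<^sub>E K\<in>\<C>. K) = transversals \<C>"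
    proof (intro equalityI subsetI)
      fix Y assume "Y \<in> (\<lambda>f. f ` \<C>) ` (\<Pi>\<^sub>E K\<in>\<C>. K)"
      then obtain f where choice: "f \<in> (\<Pi>\<^sub>E K\<in>\<C>. K)" and Y: "Y = f ` \<C>"
        by blast
      have f: "f K \<in> K" if "K \<in> \<C>" for K
        using PiE_mem[OF choice that] .
      have "y = f K" if "K \<in> \<C>" "y \<in> Y \<inter> K" for y K
        using that f unique[OF \<open>K \<in> \<C>\<close>] Y by auto
      then have "\<exists>!y. y \<in> Y \<inter> K" if "K \<in> \<C>" for K
        using that f[OF that] Y by (intro ex1I[of _ "f K"]) blast+
      moreover have "Y \<subseteq> \<Union>\<C>"
        using f Y by blast
      ultimately show "Y \<in> transversals \<C>"
        by (simp add: transversals_def)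
    next
      fix Y assume "Y \<in> transversals \<C>"
      then have Y: "Y \<subseteq> \<Union>\<C>" and ex1: "\<And>K. K \<in> \<C> \<Longrightarrow> \<exists>!y. y \<in> Y \<inter> K"
        by (auto simp: transversals_def)
      define f where "f = (\<lambda>K\<in>\<C>. THE y. y \<in> Y \<inter> K)"
      have f: "f K \<in> Y \<inter> K" if "K \<in> \<C>" for K
        using theI'[OF ex1[OF that]] that by (simp add: f_def)
      then have "f \<in> (\<Pi>\<^sub>E K\<in>\<C>. K)"
        by (auto simp: f_def)
      moreover have "Y = f ` \<C>"
      proof (intro equalityI subsetI)
        fix y assume y: "y \<in> Y"
        then obtain K where K: "K \<in> \<C>" "y \<in> K"
          using Y by blast
        then have "y = f K"
          using y ex1[OF K(1)] f[OF K(1)] by (metis IntI)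
        then show "y \<in> f ` \<C>"
          using K by blast
      qed (use f in blast)
      ultimately show "Y \<in> (\<lambda>f. f ` \<C>) ` (\<Pi>\<^sub>E K\<in>\<C>. K)"
        by blast
    qed
  qed
  then have "card (transversals \<C>) = card (\<Pi>\<^sub>E K\<in>\<C>. K)"
    by (simp add: bij_betw_same_card)
  then show ?thesis
    by (simp add: card_PiE[OF \<open>finite \<C>\<close>])
qed

text \<open>An element of a coset determines it, so choosing one element from each member of \<open>\<C>\<close> makes
  the projection to the quotient a bijection onto \<open>\<C>\<close>.  In this form transversals can be fed into
  \<open>perfect_code_cayley_quotient_iff\<close>.\<close>

lemma transversal_of_cosets:
  fixes G (structure)
  assumes "group G" and "subgroup H G" and \<C>: "\<C> \<subseteq> rcosets H" and Y: "Y \<in> transversals \<C>"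
  shows "Y \<subseteq> carrier G" and "inj_on (\<lambda>x. H #> x) Y" and "coset_image G H Y = \<C>"
proof -
  interpret group G by fact
  interpret subgroup H G by fact
  have Y': "Y \<subseteq> \<Union>\<C>" and ex1: "\<And>K. K \<in> \<C> \<Longrightarrow> \<exists>!y. y \<in> Y \<inter> K"
    using Y by (auto simp: transversals_def)
  have coset: "H #> y = K" if "K \<in> \<C>" "y \<in> K" for y K
  proof -
    have "K \<in> rcosets H"
      using that(1) \<C> by (rule rev_subsetD)
    then obtain x where x: "x \<in> carrier G" "K = H #> x"
      by (auto simp: RCOSETS_def)
    then show ?thesis
      using repr_independence[OF _ x(1) \<open>subgroup H G\<close>, of y] that(2) by simp
  qed
  show carr: "Y \<subseteq> carrier G"
    using Y' \<C> rcosets_part_G[OF \<open>subgroup H G\<close>] by blast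
  have mem: "H #> y \<in> \<C> \<and> y \<in> H #> y" if y: "y \<in> Y" for y
  proof -
    obtain K where "K \<in> \<C>" "y \<in> K"
      using y Y' by blast
    then show ?thesis
      using coset by simp
  qed
  show "inj_on (\<lambda>x. H #> x) Y"
  proof (rule inj_onI)
    fix x y assume "x \<in> Y" "y \<in> Y" "H #> x = H #> y"
    then show "x = y"
      using ex1[of "H #> x"] mem by (metis IntI)
  qed
  show "coset_image G H Y = \<C>"
    unfolding coset_image_def
  proof (intro equalityI subsetI)
    fix K assume K: "K \<in> \<C>"
    then obtain y where "y \<in> Y" "y \<in> K"
      using ex1 by blast
    then show "K \<in> (\<lambda>y. H #> y) ` Y"
      using coset[OF K] by blast
  qed (use mem in blast)
qed

section \<open>The stabilizer of the connection set\<close>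

text \<open>Commutativity turns translation on the right into multiplication by \<open>H\<close> on the left.\<close>

lemma coset_of_stabilizer_subset:
  fixes G (structure)
  assumes "comm_group G" and A: "A \<subseteq> carrier G" and a: "a \<in> A"
  shows "translation_stabilizer G A #> a \<subseteq> A"
proof
  interpret comm_group G by fact
  fix x assume "x \<in> translation_stabilizer G A #> a"
  then obtain h where h: "h \<in> carrier G" "A #> h = A" and x: "x = h \<otimes> a"
    by (auto simp: translation_stabilizer_def r_coset_def)
  have "x = a \<otimes> h"
    using x h A a by (simp add: m_comm subset_iff)
  then have "x \<in> A #> h"
    using a by (auto simp: r_coset_def)
  then show "x \<in> A"
    using h by simp
qed

theorem lemma4p9:
  fixes G :: "('a, 'm) monoid_scheme" and S S0 H :: "'a set"
  assumes "comm_group G" and "finite (carrier G)"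
    and "S \<noteq> {}" and "S \<subset> carrier G - {\<one>\<^bsub>G\<^esub>}"
    and "(\<lambda>s. inv\<^bsub>G\<^esub> s) ` S = S"
    and "generate G S = carrier G"
    and "S0 = S \<union> {\<one>\<^bsub>G\<^esub>}"
    and "H = translation_stabilizer G S0"
  shows "((\<exists>C. perfect_code (cayley_graph G S) C) \<longleftrightarrow>
            (\<exists>Y. perfect_code (cayley_graph (G Mod H) (coset_image G H S - {H})) Y))
       \<and> (\<forall>C. perfect_code (cayley_graph G S) C \<longrightarrow>
            perfect_code (cayley_graph (G Mod H) (coset_image G H S - {H})) (coset_image G H C))
       \<and> (\<forall>\<C>. perfect_code (cayley_graph (G Mod H) (coset_image G H S - {H})) \<C> \<longrightarrow>
            (\<forall>C \<in> transversals \<C>. perfect_code (cayley_graph G S) C) \<and>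
            card (transversals \<C>) = card H ^ card \<C>)"
proof -
  interpret comm_group G by fact
  let ?\<Gamma> = "cayley_graph G S"
  let ?\<Delta> = "cayley_graph (G Mod H) (coset_image G H S - {H})"
  have S0: "S0 \<subseteq> carrier G" "\<one>\<^bsub>G\<^esub> \<in> S0"
    using assms(4,7) by auto
  have sub: "subgroup H G"
    using subgroup_translation_stabilizer[OF is_group S0(1)] assms(8) by simp
  have norm: "H \<lhd> G"
    using subgroup_imp_normal[OF sub] .
  have sat: "H #>\<^bsub>G\<^esub> t \<subseteq> S0" if "t \<in> S0" for t
    using coset_of_stabilizer_subset[OF assms(1) S0(1) that] assms(8) by simp
  have S: "S0 - {\<one>\<^bsub>G\<^esub>} = S"
    using assms(4,7) by auto
  have "H #>\<^bsub>G\<^esub> \<one>\<^bsub>G\<^esub> = H"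
    using coset_mult_one[OF subgroup.subset[OF sub]] .
  then have SH: "coset_image G H S0 - {H} = coset_image G H S - {H}"
    using assms(7) by (auto simp: coset_image_def)
  have code_iff: "perfect_code ?\<Gamma> C \<longleftrightarrow>
      inj_on (\<lambda>x. H #>\<^bsub>G\<^esub> x) C \<and> perfect_code ?\<Delta> (coset_image G H C)" if "C \<subseteq> carrier G" for C
    using perfect_code_cayley_quotient_iff[OF norm S0(1) sat S0(2) that] unfolding S SH .
  have down: "perfect_code ?\<Delta> (coset_image G H C)" if "perfect_code ?\<Gamma> C" for C
  proof -
    have "C \<subseteq> carrier G"
      using that by (simp add: perfect_code_def cayley_graph_def)
    then show ?thesis
      using that code_iff by blast
  qed
  have up: "(\<forall>C\<in>transversals \<C>. perfect_code ?\<Gamma> C) \<and> card (transversals \<C>) = card H ^ card \<C>"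
    if code: "perfect_code ?\<Delta> \<C>" for \<C>
  proof
    have \<C>: "\<C> \<subseteq> rcosets\<^bsub>G\<^esub> H"
      using code by (simp add: perfect_code_def cayley_graph_def FactGroup_def)
    show "\<forall>C\<in>transversals \<C>. perfect_code ?\<Gamma> C"
      using transversal_of_cosets[OF is_group sub \<C>] code_iff code by metis
    have "finite (rcosets\<^bsub>G\<^esub> H)"
      using assms(2) by (simp add: RCOSETS_def)
    then have "finite \<C>"
      using \<C> finite_subset by blast
    moreover have "pairwise disjnt \<C>"
      using rcos_disjoint[OF sub] \<C> by (rule pairwise_subset)
    ultimately have "card (transversals \<C>) = (\<Prod>K\<in>\<C>. card K)"
      by (rule card_transversals)
    also have "\<dots> = (\<Prod>K\<in>\<C>. card H)"
      using \<C> card_rcosets_equal[OF _ subgroup.subset[OF sub]] by (intro prod.cong) auto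
    finally show "card (transversals \<C>) = card H ^ card \<C>"
      by simp
  qed
  have lift: "\<exists>C. perfect_code ?\<Gamma> C" if "perfect_code ?\<Delta> \<C>" for \<C>
  proof -
    have "card H > 0"
      using subgroup.finite_imp_card_positive[OF sub assms(2)] .
    then have "card (transversals \<C>) \<noteq> 0"
      using up[OF that] by simp
    then have "transversals \<C> \<noteq> {}"
      by fastforce
    then show ?thesis
      using up[OF that] by blast
  qed
  show ?thesis
    using down up lift by blast
qed

end
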